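(* Let $\Omega\subset\mathbb{R}$ be a bounded open interval, let $1<p<\infty$, $q=\frac{p}{p-1}$, and let $V_h\subset H_0^1(\Omega)$ be the finite element space of piecewise polynomials of degree at most $r-1$, $r\ge 2$, associated with a partition $\mathcal{T}_h$ of $\Omega$. If $f\in L^2(\Omega)$, then the pair $(u_h,v_h)\in V_h\times V_h$ satisfying $$(\nabla v_h,\nabla\psi_h) = -(f,\psi_h) \quad \forall\,\psi_h\in V_h, \qquad (\nabla u_h,\nabla\eta_h) = -(|v_h|^{q-2}v_h,\eta_h) \quad \forall\,\eta_h\in V_h$$ is unique.
   Context: $(\cdot,\cdot)$ denotes the $L^2(\Omega)$ inner product, and $\nabla$ is the (weak) derivative in dimension one. $\mathcal{T}_h$ is a partition of $\Omega$ into finitely many nondegenerate intervals $T_1,\dots,T_n$ with pairwise disjoint interiors, whose parameter $h$ is the mesh size. For an integer $r\ge 2$, $$V_h=\{w\in C(\overline\Omega): w=0 \text{ on } \partial\Omega,\ w|_{T_k} \text{ is a polynomial of degree at most } r-1 \text{ for every } T_k\in\mathcal{T}_h\}.$$ The expression $|v_h|^{q-2}v_h$ is understood to be $0$ where $v_h=0$. *)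

theory Defs
  imports "HOL-Analysis.Analysis" "HOL-Computational_Algebra.Polynomial"
begin

definition L2_space :: "real set \<Rightarrow> (real \<Rightarrow> real) set" where
  "L2_space \<Omega> = {f \<in> borel_measurable (lebesgue_on \<Omega>). integrable (lebesgue_on \<Omega>) (\<lambda>x. (f x)\<^sup>2)}"

definition L2_inner :: "real set \<Rightarrow> (real \<Rightarrow> real) \<Rightarrow> (real \<Rightarrow> real) \<Rightarrow> real" where
  "L2_inner \<Omega> f g = integral\<^sup>L (lebesgue_on \<Omega>) (\<lambda>x. f x * g x)"

definition test_functions :: "real set \<Rightarrow> (real \<Rightarrow> real) set" where
  "test_functions \<Omega> = {\<phi>. (\<forall>k x. (deriv ^^ k) \<phi> field_differentiable at x) \<and>
     (\<exists>K. compact K \<and> K \<subseteq> \<Omega> \<and> (\<forall>x. x \<notin> K \<longrightarrow> \<phi> x = 0))}"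

definition locally_integrable_on :: "(real \<Rightarrow> real) \<Rightarrow> real set \<Rightarrow> bool" where
  "locally_integrable_on g \<Omega> \<longleftrightarrow> (\<forall>K. compact K \<and> K \<subseteq> \<Omega> \<longrightarrow> integrable (lebesgue_on K) g)"

definition has_weak_deriv :: "real set \<Rightarrow> (real \<Rightarrow> real) \<Rightarrow> (real \<Rightarrow> real) \<Rightarrow> bool" where
  "has_weak_deriv \<Omega> w g \<longleftrightarrow> locally_integrable_on w \<Omega> \<and> locally_integrable_on g \<Omega> \<and>
     (\<forall>\<phi> \<in> test_functions \<Omega>. L2_inner \<Omega> w (deriv \<phi>) = - L2_inner \<Omega> g \<phi>)"

(* A weak derivative is determined only almost everywhere; this picks one representative. *)
definition weak_deriv :: "real set \<Rightarrow> (real \<Rightarrow> real) \<Rightarrow> real \<Rightarrow> real" where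
  "weak_deriv \<Omega> w = (SOME g. has_weak_deriv \<Omega> w g)"

(* The cells are closed intervals (division_of allows one-point cells, hence the second conjunct). *)
definition mesh_partition :: "real set set \<Rightarrow> real set \<Rightarrow> bool" where
  "mesh_partition \<T> \<Omega> \<longleftrightarrow> \<T> division_of closure \<Omega> \<and> (\<forall>T \<in> \<T>. interior T \<noteq> {})"

(* A function on the closure of the domain is represented by its extension by zero to the
   real line, so that equality in the finite element space is equality of functions. *)
definition fe_space :: "real set \<Rightarrow> real set set \<Rightarrow> nat \<Rightarrow> (real \<Rightarrow> real) set" where
  "fe_space \<Omega> \<T> r = {w. continuous_on (closure \<Omega>) w \<and> (\<forall>x \<in> frontier \<Omega>. w x = 0) \<and>
     (\<forall>T \<in> \<T>. \<exists>P :: real poly. degree P \<le> r - 1 \<and> (\<forall>x \<in> T. w x = poly P x)) \<and>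
     (\<forall>x. x \<notin> closure \<Omega> \<longrightarrow> w x = 0)}"

end

theory Submission
  imports Defs "HOL-Library.Function_Algebras"
begin

text \<open>Each of the two equations has the form \<open>(v', \<psi>') = - (g, \<psi>)\<close> for all test functions \<open>\<psi>\<close> in the finite
element space: the first with \<open>g = f\<close>, the second, once \<open>v\<close> is known, with
\<open>g = \<bar>v\<bar>\<^bsup>q-2\<^esup> v\<close>. The system is triangular, so it suffices that one such equation has exactly one
solution for every integrable \<open>g\<close>; this is \<open>galerkin_unique_solvable\<close>. It applies to \<open>f\<close> because
square-integrable functions on a bounded interval are integrable, and to \<open>\<bar>v\<bar>\<^bsup>q-2\<^esup> v\<close> because
\<open>q > 1\<close> makes this function bounded by a power of \<open>max \<bar>v\<bar>\<close>.

The finite element space is finite-dimensional (\<open>fe_space_in_finite_span\<close>), and the energy form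
\<open>(v', \<psi>')\<close> is definite on it: if \<open>(v', v') = 0\<close> then \<open>v' = 0\<close> almost everywhere, so the continuous
piecewise smooth function \<open>v\<close>, being the integral of its derivative from the left end point, where
it vanishes, is zero (\<open>energy_definite\<close>). A definite symmetric form on a finite-dimensional space
represents every linear functional by exactly one vector (\<open>finite_dim_riesz\<close>).

What connects this with the statement is the meaning of \<open>weak_deriv\<close>, which is an arbitrarily chosen
weak derivative. Integration by parts shows that the classical derivative away from the nodes is
one weak derivative (\<open>pw_deriv_has_weak_deriv\<close>), and weak derivatives agree almost everywhere
(\<open>weak_deriv_unique\<close>) by the fundamental lemma of the calculus of variations. That lemma needs
enough smooth functions of compact support; they are built by hand from \<open>exp (- 1 / x)\<close>.\<close>


section \<open>Smooth functions of compact support\<close>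

text \<open>The powers of \<open>x\<close> in the denominator make the family closed under differentiation up to linear
combinations, so that smoothness of \<open>exp (- 1 / x)\<close>, continued by \<open>0\<close>, needs only first derivatives.\<close>
definition flat :: "nat \<Rightarrow> real \<Rightarrow> real" where
  "flat k x = (if x > 0 then exp (- (1 / x)) / x ^ k else 0)"

text \<open>With \<open>y = 1 / x\<close> this is the fact that \<open>exp y\<close> outgrows every power of \<open>y\<close>. It says that the
derivative of every \<open>flat k\<close> at \<open>0\<close> exists and is \<open>0\<close>.\<close>
lemma flat_quotient_tendsto_0: "((\<lambda>x. flat k x / x) \<longlongrightarrow> 0) (at 0)"
proof -
  have "((\<lambda>x::real. (inverse x) ^ Suc k / exp (inverse x)) \<longlongrightarrow> 0) (at_right 0)"
    by (rule filterlim_compose[OF tendsto_power_div_exp_0 filterlim_inverse_at_top_right])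
  then have right: "((\<lambda>x. flat k x / x) \<longlongrightarrow> 0) (at_right 0)"
    by (rule filterlim_cong[THEN iffD1, OF refl refl, rotated])
       (auto simp: flat_def eventually_at_filter exp_minus field_simps)
  have left: "((\<lambda>x. flat k x / x) \<longlongrightarrow> 0) (at_left 0)"
    by (rule filterlim_cong[THEN iffD1, OF refl refl _ tendsto_const])
       (auto simp: flat_def eventually_at_filter)
  show ?thesis
    using left right by (simp add: filterlim_at_split)
qed

lemma flat_has_derivative:
  "(flat k has_real_derivative flat (Suc (Suc k)) x - real k * flat (Suc k) x) (at x)"
proof -
  consider "x < 0" | "x = 0" | "x > 0" by linarith
  then show ?thesis
  proof cases
    case 1
    have "(flat k has_real_derivative 0) (at x)"
      by (rule has_field_derivative_transform_within_open[where f="\<lambda>_. 0" and S="{..<0}"])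
         (use 1 in \<open>auto simp: flat_def\<close>)
    with 1 show ?thesis by (simp add: flat_def)
  next
    case 2
    then show ?thesis
      using flat_quotient_tendsto_0[of k] by (simp add: has_field_derivative_iff flat_def)
  next
    case 3
    have "((\<lambda>x. exp (- (1 / x)) / x ^ k) has_real_derivative
        flat (Suc (Suc k)) x - real k * flat (Suc k) x) (at x)"
      using 3
      apply (cases k)
       apply (auto intro!: derivative_eq_intros simp: flat_def field_simps power2_eq_square)
      subgoal for j by (cases j) auto
      done
    then show ?thesis
      by (rule has_field_derivative_transform_within_open[where S="{0<..}"])
         (use 3 in \<open>auto simp: flat_def\<close>)
  qed
qed

lemma flat_0_bounds: "0 \<le> flat 0 x" "flat 0 x \<le> 1" "0 < flat 0 x \<longleftrightarrow> 0 < x"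
  by (auto simp: flat_def)

text \<open>An algebra of functions that contains the derivatives of its members: such functions are
infinitely differentiable, and no formula for the higher derivatives is ever needed.\<close>
inductive_set flat_algebra :: "(real \<Rightarrow> real) set" where
  const: "(\<lambda>_. c) \<in> flat_algebra"
| left: "(\<lambda>x. flat k (x - c)) \<in> flat_algebra"
| right: "(\<lambda>x. flat k (c - x)) \<in> flat_algebra"
| add: "f \<in> flat_algebra \<Longrightarrow> g \<in> flat_algebra \<Longrightarrow> (\<lambda>x. f x + g x) \<in> flat_algebra"
| mult: "f \<in> flat_algebra \<Longrightarrow> g \<in> flat_algebra \<Longrightarrow> (\<lambda>x. f x * g x) \<in> flat_algebra"

lemma flat_algebra_diff:
  assumes "f \<in> flat_algebra" "g \<in> flat_algebra"
  shows "(\<lambda>x. f x - g x) \<in> flat_algebra"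
  using flat_algebra.add[OF assms(1) flat_algebra.mult[OF flat_algebra.const[of "-1"] assms(2)]]
  by simp

lemma flat_algebra_power: "f \<in> flat_algebra \<Longrightarrow> (\<lambda>x. f x ^ n) \<in> flat_algebra"
  by (induction n) (auto intro: flat_algebra.intros)

lemma flat_algebra_has_derivative:
  "f \<in> flat_algebra \<Longrightarrow> \<exists>f' \<in> flat_algebra. \<forall>x. (f has_real_derivative f' x) (at x)"
proof (induction rule: flat_algebra.induct)
  case (const c)
  show ?case by (rule bexI[OF _ flat_algebra.const[of 0]]) auto
next
  case (left k c)
  have "\<forall>x. ((\<lambda>x. flat k (x - c)) has_real_derivative
      flat (Suc (Suc k)) (x - c) - real k * flat (Suc k) (x - c)) (at x)"
  proof
    fix x
    have "((\<lambda>x. x - c) has_real_derivative 1) (at x)"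
      by (auto intro!: derivative_eq_intros)
    from DERIV_chain2[OF flat_has_derivative this, of k]
    show "((\<lambda>x. flat k (x - c)) has_real_derivative flat (Suc (Suc k)) (x - c) - real k * flat (Suc k) (x - c)) (at x)"
      by simp
  qed
  moreover have "(\<lambda>x. flat (Suc (Suc k)) (x - c) - real k * flat (Suc k) (x - c)) \<in> flat_algebra"
    by (intro flat_algebra_diff flat_algebra.intros)
  ultimately show ?case by (rule bexI)
next
  case (right k c)
  have "\<forall>x. ((\<lambda>x. flat k (c - x)) has_real_derivative
      real k * flat (Suc k) (c - x) - flat (Suc (Suc k)) (c - x)) (at x)"
  proof
    fix x
    have "((\<lambda>x. c - x) has_real_derivative - 1) (at x)"
      by (auto intro!: derivative_eq_intros)
    from DERIV_chain2[OF flat_has_derivative this, of k]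
    show "((\<lambda>x. flat k (c - x)) has_real_derivative real k * flat (Suc k) (c - x) - flat (Suc (Suc k)) (c - x)) (at x)"
      by simp
  qed
  moreover have "(\<lambda>x. real k * flat (Suc k) (c - x) - flat (Suc (Suc k)) (c - x)) \<in> flat_algebra"
    by (intro flat_algebra_diff flat_algebra.intros)
  ultimately show ?case by (rule bexI)
next
  case (add f g)
  then obtain f' g' where "f' \<in> flat_algebra" "\<forall>x. (f has_real_derivative f' x) (at x)"
    "g' \<in> flat_algebra" "\<forall>x. (g has_real_derivative g' x) (at x)" by blast
  then show ?case
    by (intro bexI[where x="\<lambda>x. f' x + g' x"]) (auto intro!: flat_algebra.intros DERIV_add)
next
  case (mult f g)
  then obtain f' g' where "f' \<in> flat_algebra" "\<forall>x. (f has_real_derivative f' x) (at x)"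
    "g' \<in> flat_algebra" "\<forall>x. (g has_real_derivative g' x) (at x)" by blast
  with mult show ?case
    by (intro bexI[where x="\<lambda>x. f' x * g x + g' x * f x"])
       (auto intro!: flat_algebra.intros DERIV_mult)
qed

lemma flat_algebra_smooth:
  assumes "f \<in> flat_algebra"
  shows "(deriv ^^ k) f field_differentiable at x"
proof -
  have "(deriv ^^ k) f \<in> flat_algebra"
  proof (induction k)
    case (Suc k)
    then obtain f' where "f' \<in> flat_algebra" and "\<forall>x. ((deriv ^^ k) f has_real_derivative f' x) (at x)"
      using flat_algebra_has_derivative by blast
    moreover from this have "deriv ((deriv ^^ k) f) = f'"
      by (auto intro: DERIV_imp_deriv)
    ultimately show ?case by simp
  qed (use assms in simp)
  then show ?thesis
    using flat_algebra_has_derivative field_differentiable_def by blast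
qed

text \<open>The product of the two \<open>flat 0\<close> terms is a bump with values in \<open>(0, 1)\<close> on \<open>(c, d)\<close> and \<open>0\<close> elsewhere.
Hence the power tends to \<open>0\<close> inside and is constantly \<open>1\<close> outside: for growing \<open>n\<close> these test
functions approach the indicator function of \<open>(c, d)\<close>.\<close>
definition plateau :: "real \<Rightarrow> real \<Rightarrow> nat \<Rightarrow> real \<Rightarrow> real" where
  "plateau c d n x = 1 - (1 - flat 0 (x - c) * flat 0 (d - x)) ^ n"

lemma plateau_in_test_functions:
  assumes "{c..d} \<subseteq> \<Omega>"
  shows "plateau c d n \<in> test_functions \<Omega>"
proof -
  have "plateau c d n \<in> flat_algebra"
    unfolding plateau_def[abs_def]
    by (intro flat_algebra_diff flat_algebra_power flat_algebra.intros)
  moreover have "plateau c d n x = 0" if "x \<notin> {c..d}" for x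
    using that by (auto simp: plateau_def flat_def)
  ultimately show ?thesis
    using assms flat_algebra_smooth unfolding test_functions_def by blast
qed

lemma plateau_outside: "x \<notin> {c<..<d} \<Longrightarrow> plateau c d n x = 0"
  by (auto simp: plateau_def flat_def)

lemma flat_product_in_unit: "1 - flat 0 x * flat 0 y \<in> {0..1}"
  using flat_0_bounds(1,2)[of x] flat_0_bounds(1,2)[of y] by (auto simp: mult_le_one)

lemma abs_plateau_le_1: "\<bar>plateau c d n x\<bar> \<le> 1"
  using flat_product_in_unit[of "x - c" "d - x"]
  by (auto simp: plateau_def abs_le_iff power_le_one intro: order_trans[OF _ zero_le_power])

lemma plateau_tendsto_indicator:
  "(\<lambda>n. plateau c d n x) \<longlonglongrightarrow> indicator {c<..<d} x"
proof (cases "x \<in> {c<..<d}")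
  case True
  then have "0 < flat 0 (x - c) * flat 0 (d - x)"
    using flat_0_bounds(3) by simp
  then have "(\<lambda>n. (1 - flat 0 (x - c) * flat 0 (d - x)) ^ n) \<longlonglongrightarrow> 0"
    using flat_product_in_unit[of "x - c" "d - x"] by (intro LIMSEQ_realpow_zero) auto
  then show ?thesis
    unfolding plateau_def using True tendsto_diff[OF tendsto_const[of 1]] by fastforce
qed (simp add: plateau_outside)


section \<open>The fundamental lemma and uniqueness of weak derivatives\<close>

text \<open>The positive and the negative part of \<open>f\<close> are densities of two finite measures that agree on all
rays; rays determine a Borel measure on the line, and measures determine their densities.\<close>
lemma AE_zero_if_integral_rays_zero:
  fixes f :: "real \<Rightarrow> real"
  assumes f: "integrable lebesgue f"
    and rays: "\<And>c. (\<integral>x. indicator {c<..} x * f x \<partial>lebesgue) = 0"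
  shows "AE x in lebesgue. f x = 0"
proof -
  \<comment> \<open>Measures on the line are compared on Borel sets, hence the passage to a Borel representative.\<close>
  obtain g where g_meas [measurable]: "g \<in> borel_measurable lborel" and fg: "AE x in lborel. f x = g x"
    using completion_ex_borel_measurable_real[OF borel_measurable_integrable[OF f]] by blast
  have fg': "AE x in lebesgue. f x = g x"
    using fg by (rule AE_completion)
  have "integrable lebesgue g"
    using f fg' g_meas by (intro integrable_cong_AE_imp[OF f measurable_completion]) (auto simp: eq_commute)
  then have g: "integrable lborel g"
    using g_meas integrable_completion by blast
  have g_rays: "(\<integral>x. indicator {c<..} x * g x \<partial>lborel) = 0" for c
  proof -
    have "(\<integral>x. indicator {c<..} x * g x \<partial>lborel) = (\<integral>x. indicator {c<..} x * g x \<partial>lebesgue)"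
      by (rule integral_completion[symmetric]) measurable
    also have "\<dots> = (\<integral>x. indicator {c<..} x * f x \<partial>lebesgue)"
    proof (rule integral_cong_AE)
      show "AE x in lebesgue. indicator {c<..} x * g x = indicator {c<..} x * f x"
        using fg' by eventually_elim simp
      show "(\<lambda>x. indicator {c<..} x * g x) \<in> borel_measurable lebesgue"
        by (rule measurable_completion) measurable
      show "(\<lambda>x. indicator {c<..} x * f x) \<in> borel_measurable lebesgue"
        by (intro borel_measurable_times borel_measurable_integrable[OF f] borel_measurable_indicator) simp
    qed
    finally show ?thesis using rays by simp
  qed
  have g_ray_int: "integrable lborel (\<lambda>x. indicator {c<..} x * g x)" for c
    using integrable_mult_indicator[OF _ g, of "{c<..}"] by simp
  \<comment> \<open>As \<open>ennreal\<close> maps negative numbers to \<open>0\<close>, these densities are the positive and the negative part of \<open>g\<close>.\<close>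
  let ?P = "density lborel (\<lambda>x. ennreal (g x))" and ?N = "density lborel (\<lambda>x. ennreal (- g x))"
  have P: "emeasure ?P {c<..} = (\<integral>\<^sup>+x. ennreal (indicator {c<..} x * g x) \<partial>lborel)" for c
    by (auto simp: emeasure_density indicator_def intro!: nn_integral_cong)
  have N: "emeasure ?N {c<..} = (\<integral>\<^sup>+x. ennreal (- (indicator {c<..} x * g x)) \<partial>lborel)" for c
    by (auto simp: emeasure_density indicator_def intro!: nn_integral_cong)
  have P_fin: "emeasure ?P {c<..} < \<infinity>" and N_fin: "emeasure ?N {c<..} < \<infinity>" for c
    using g_ray_int[of c] unfolding P N real_integrable_def by (auto simp: top.not_eq_extremum)
  have "?P = ?N"
  proof (rule measure_eqI_lessThan)
    fix c
    have "enn2real (emeasure ?P {c<..}) = enn2real (emeasure ?N {c<..})"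
      using g_rays[of c] real_lebesgue_integral_def[OF g_ray_int[of c]] by (simp add: P N)
    then show "emeasure ?P {c<..} = emeasure ?N {c<..}"
      using P_fin[of c] N_fin[of c]
      by (metis ennreal_enn2real infinity_ennreal_def)
  qed (use P_fin in auto)
  then have "AE x in lborel. ennreal (g x) = ennreal (- g x)"
  proof (subst (asm) sigma_finite_density_unique)
    have "emeasure ?P UNIV < \<infinity>"
      using g unfolding real_integrable_def
      by (auto simp: emeasure_density top.not_eq_extremum)
    then show "sigma_finite_measure ?P"
      by (intro finite_measure.axioms(1) finite_measureI) auto
  qed auto
  then have "AE x in lborel. g x = 0"
    by eventually_elim (metis ennreal_eq_0_iff ennreal_neg linorder_le_cases neg_le_0_iff_le order_antisym)
  with fg have "AE x in lborel. f x = 0"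
    by eventually_elim simp
  then show ?thesis by (rule AE_completion)
qed

lemma test_function_properties:
  assumes "\<phi> \<in> test_functions \<Omega>"
  shows "(\<phi> has_real_derivative deriv \<phi> x) (at x)"
    and "continuous_on S \<phi>" and "continuous_on S (deriv \<phi>)"
    and "\<exists>K. compact K \<and> K \<subseteq> \<Omega> \<and> (\<forall>x. x \<notin> K \<longrightarrow> \<phi> x = 0)"
proof -
  have *: "((deriv ^^ k) \<phi>) field_differentiable at x" for k x
    using assms by (simp add: test_functions_def)
  show "(\<phi> has_real_derivative deriv \<phi> x) (at x)"
    using *[of 0] by (simp add: DERIV_deriv_iff_field_differentiable)
  show "continuous_on S \<phi>"
    using *[of 0] by (simp add: continuous_at_imp_continuous_on field_differentiable_imp_continuous_at)
  show "continuous_on S (deriv \<phi>)"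
    using *[of 1] by (simp add: continuous_at_imp_continuous_on field_differentiable_imp_continuous_at)
  show "\<exists>K. compact K \<and> K \<subseteq> \<Omega> \<and> (\<forall>x. x \<notin> K \<longrightarrow> \<phi> x = 0)"
    using assms by (simp add: test_functions_def)
qed

lemma continuous_on_real_lebesgue_measurable:
  "continuous_on UNIV (f :: real \<Rightarrow> real) \<Longrightarrow> f \<in> borel_measurable (lebesgue_on S)"
  by (simp add: borel_measurable_continuous_onI measurable_completion measurable_restrict_space1)

lemma integrable_bounded_mult:
  fixes f g :: "'a \<Rightarrow> real"
  assumes f: "integrable M f" and g: "g \<in> borel_measurable M" and le: "\<And>x. x \<in> space M \<Longrightarrow> \<bar>g x\<bar> \<le> C"
  shows "integrable M (\<lambda>x. f x * g x)"
proof (rule Bochner_Integration.integrable_bound)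
  show "integrable M (\<lambda>x. C * f x)" using f by simp
  show "AE x in M. norm (f x * g x) \<le> norm (C * f x)"
  proof (rule AE_I2)
    fix x assume "x \<in> space M"
    then have "\<bar>g x\<bar> \<le> \<bar>C\<bar>" using le[of x] by linarith
    then have "\<bar>g x\<bar> * \<bar>f x\<bar> \<le> \<bar>C\<bar> * \<bar>f x\<bar>" by (rule mult_right_mono) simp
    then show "norm (f x * g x) \<le> norm (C * f x)" by (simp add: abs_mult mult.commute)
  qed
qed (use f g in measurable)

lemma locally_integrable_mult_test_function:
  assumes g: "locally_integrable_on g \<Omega>" and \<phi>: "\<phi> \<in> test_functions \<Omega>"
    and \<Omega>: "\<Omega> \<in> sets lebesgue"
  shows "integrable (lebesgue_on \<Omega>) (\<lambda>x. g x * \<phi> x)"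
proof -
  obtain K where K: "compact K" "K \<subseteq> \<Omega>" and out: "\<And>x. x \<notin> K \<Longrightarrow> \<phi> x = 0"
    using test_function_properties(4)[OF \<phi>] by blast
  obtain C where "\<And>x. x \<in> K \<Longrightarrow> \<bar>\<phi> x\<bar> \<le> C"
    using compact_imp_bounded[OF compact_continuous_image[OF test_function_properties(2)[OF \<phi>] K(1)]]
    by (auto simp: bounded_iff)
  then have "integrable (lebesgue_on K) (\<lambda>x. g x * \<phi> x)"
    using g K \<phi> by (intro integrable_bounded_mult continuous_on_real_lebesgue_measurable
        test_function_properties(2)) (auto simp: locally_integrable_on_def)
  then have "integrable lebesgue (\<lambda>x. if x \<in> K then g x * \<phi> x else 0)"
    using K(1) by (subst Lebesgue_Measure.integrable_restrict_UNIV) (auto intro: lmeasurable_compact fmeasurableD)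
  also have "(\<lambda>x. if x \<in> K then g x * \<phi> x else 0) = (\<lambda>x. if x \<in> \<Omega> then g x * \<phi> x else 0)"
    using K(2) out by (auto simp: fun_eq_iff)
  finally show ?thesis
    using \<Omega> by (simp add: Lebesgue_Measure.integrable_restrict_UNIV)
qed

text \<open>Testing with \<open>plateau c d n\<close> and letting \<open>n\<close> grow gives \<open>\<integral>h = 0\<close> over \<open>(c, d)\<close> by dominated
convergence. The intervals must stay away from \<open>a\<close> and \<open>b\<close>, near which \<open>h\<close> may fail to be integrable;
countably many of them exhaust \<open>(a, b)\<close>.\<close>
lemma fundamental_lemma_calculus_of_variations:
  fixes h :: "real \<Rightarrow> real"
  assumes h: "locally_integrable_on h {a<..<b}"
    and zero: "\<And>\<phi>. \<phi> \<in> test_functions {a<..<b} \<Longrightarrow> L2_inner {a<..<b} h \<phi> = 0"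
  shows "AE x in lebesgue_on {a<..<b}. h x = 0"
proof -
  have integrable: "integrable lebesgue (\<lambda>x. indicator {c<..<d} x * h x)" if "a < c" "d < b" for c d
  proof -
    have "integrable (lebesgue_on {c..d}) h"
      using h that unfolding locally_integrable_on_def by (elim allE[of _ "{c..d}"]) auto
    then have "integrable lebesgue (\<lambda>x. indicator {c..d} x * h x)"
      by (simp add: integrable_restrict_space)
    from integrable_mult_indicator[OF _ this, of "{c<..<d}"]
    have "integrable lebesgue (\<lambda>x. indicator {c<..<d} x * (indicator {c..d} x * h x))"
      by simp
    also have "(\<lambda>x. indicator {c<..<d} x * (indicator {c..d} x * h x)) = (\<lambda>x. indicator {c<..<d} x * h x)"
      by (auto simp: indicator_def fun_eq_iff)
    finally show ?thesis .
  qed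
  have interval: "(\<integral>x. indicator {c<..<d} x * h x \<partial>lebesgue) = 0" if cd: "a < c" "d < b" for c d
  proof -
    have zeros: "(\<integral>x. indicator {c<..<d} x * h x * plateau c d n x \<partial>lebesgue) = 0" for n
    proof -
      have "(\<integral>x. indicator {c<..<d} x * h x * plateau c d n x \<partial>lebesgue)
          = (\<integral>x. (if x \<in> {a<..<b} then h x * plateau c d n x else 0) \<partial>lebesgue)"
        using cd plateau_outside[of _ c d n]
        by (intro Bochner_Integration.integral_cong) (auto simp: indicator_def)
      also have "\<dots> = L2_inner {a<..<b} h (plateau c d n)"
        unfolding L2_inner_def by (rule Lebesgue_Measure.integral_restrict_UNIV) simp
      also have "\<dots> = 0"
        using cd by (intro zero plateau_in_test_functions) auto
      finally show ?thesis .
    qed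
    have "(\<lambda>n. \<integral>x. indicator {c<..<d} x * h x * plateau c d n x \<partial>lebesgue)
        \<longlonglongrightarrow> (\<integral>x. indicator {c<..<d} x * h x \<partial>lebesgue)"
    proof (rule integral_dominated_convergence[where w="\<lambda>x. norm (indicator {c<..<d} x * h x)"])
      show meas: "(\<lambda>x. indicator {c<..<d} x * h x) \<in> borel_measurable lebesgue"
        using integrable[OF cd] by (rule borel_measurable_integrable)
      show "integrable lebesgue (\<lambda>x. norm (indicator {c<..<d} x * h x))"
        using integrable[OF cd] by (rule integrable_norm)
      show "AE x in lebesgue. (\<lambda>n. indicator {c<..<d} x * h x * plateau c d n x)
          \<longlonglongrightarrow> indicator {c<..<d} x * h x"
      proof (rule AE_I2)
        fix x
        have "(\<lambda>n. indicator {c<..<d} x * h x * plateau c d n x)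
            \<longlonglongrightarrow> indicator {c<..<d} x * h x * indicator {c<..<d} x"
          by (intro tendsto_mult tendsto_const plateau_tendsto_indicator)
        then show "(\<lambda>n. indicator {c<..<d} x * h x * plateau c d n x)
            \<longlonglongrightarrow> indicator {c<..<d} x * h x"
          by (cases "x \<in> {c<..<d}") simp_all
      qed
      fix n
      show "AE x in lebesgue. norm (indicator {c<..<d} x * h x * plateau c d n x)
          \<le> norm (indicator {c<..<d} x * h x)"
        using abs_plateau_le_1 by (auto intro!: AE_I2 mult_left_le simp: abs_mult)
      have "continuous_on UNIV (plateau c d n)"
        using cd by (intro test_function_properties(2)[of _ "{a<..<b}"] plateau_in_test_functions) auto
      then have "plateau c d n \<in> borel_measurable lebesgue"
        using continuous_on_real_lebesgue_measurable[of _ UNIV] by (simp add: lebesgue_on_UNIV_eq)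
      with meas show "(\<lambda>x. indicator {c<..<d} x * h x * plateau c d n x) \<in> borel_measurable lebesgue"
        by (rule borel_measurable_times)
    qed
    then show ?thesis
      by (simp add: zeros LIMSEQ_const_iff)
  qed
  have "AE x in lebesgue. indicator {c<..<d} x * h x = 0" if cd: "a < c" "d < b" for c d
  proof (rule AE_zero_if_integral_rays_zero[OF integrable[OF cd]])
    fix e
    have "(\<lambda>x. indicator {e<..} x * (indicator {c<..<d} x * h x)) = (\<lambda>x. indicator {max c e<..<d} x * h x)"
      by (auto simp: fun_eq_iff indicator_def)
    then show "(\<integral>x. indicator {e<..} x * (indicator {c<..<d} x * h x) \<partial>lebesgue) = 0"
      using interval[of "max c e" d] cd by simp
  qed
  then have "AE x in lebesgue. \<forall>n. indicator {a + 1 / real (Suc n)<..<b - 1 / real (Suc n)} x * h x = 0"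
    by (subst AE_all_countable) simp
  then have "AE x in lebesgue. x \<in> {a<..<b} \<longrightarrow> h x = 0"
  proof eventually_elim
    case (elim x)
    show ?case
    proof
      assume "x \<in> {a<..<b}"
      then obtain n where "inverse (real (Suc n)) < min (x - a) (b - x)"
        using reals_Archimedean[of "min (x - a) (b - x)"] by auto
      then have "x \<in> {a + 1 / real (Suc n)<..<b - 1 / real (Suc n)}"
        by (auto simp: field_simps)
      with elim[rule_format, of n] show "h x = 0" by (simp add: indicator_def)
    qed
  qed
  then show ?thesis
    by (simp add: AE_restrict_space_iff)
qed

lemma weak_deriv_unique:
  assumes "has_weak_deriv {a<..<b} w g" and "has_weak_deriv {a<..<b} w h"
  shows "AE x in lebesgue_on {a<..<b}. g x = h x"
proof -
  have loc: "locally_integrable_on g {a<..<b}" "locally_integrable_on h {a<..<b}"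
    using assms by (auto simp: has_weak_deriv_def)
  have "AE x in lebesgue_on {a<..<b}. g x - h x = 0"
  proof (rule fundamental_lemma_calculus_of_variations)
    show "locally_integrable_on (\<lambda>x. g x - h x) {a<..<b}"
      using loc by (auto simp: locally_integrable_on_def)
    fix \<phi> assume \<phi>: "\<phi> \<in> test_functions {a<..<b}"
    have "L2_inner {a<..<b} (\<lambda>x. g x - h x) \<phi> = L2_inner {a<..<b} g \<phi> - L2_inner {a<..<b} h \<phi>"
      using loc[THEN locally_integrable_mult_test_function, OF \<phi>]
      by (simp add: L2_inner_def left_diff_distrib)
    also have "\<dots> = 0"
      using assms \<phi> by (simp add: has_weak_deriv_def)
    finally show "L2_inner {a<..<b} (\<lambda>x. g x - h x) \<phi> = 0" .
  qed
  then show ?thesis by simp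
qed


section \<open>Representation of functionals on a finite-dimensional space\<close>

text \<open>Existence is Gram--Schmidt, adding one spanning vector at a time: the component of the new vector
orthogonal to the previous ones is obtained by representing the functional \<open>form e\<close>, and the previous
representative is then corrected by a multiple of that component.\<close>
lemma finite_dim_riesz:
  fixes scale :: "real \<Rightarrow> 'v::ab_group_add \<Rightarrow> 'v" and form :: "'v \<Rightarrow> 'v \<Rightarrow> real"
  assumes vs: "vector_space scale" and V: "module.subspace scale V"
    and B: "finite B" "V \<subseteq> module.span scale B"
    and form_add: "\<And>x y z. \<lbrakk>x \<in> V; y \<in> V; z \<in> V\<rbrakk> \<Longrightarrow> form (x + y) z = form x z + form y z"
    and form_scale: "\<And>c x z. \<lbrakk>x \<in> V; z \<in> V\<rbrakk> \<Longrightarrow> form (scale c x) z = c * form x z"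
    and form_sym: "\<And>x y. form x y = form y x"
    and form_def: "\<And>x. \<lbrakk>x \<in> V; form x x = 0\<rbrakk> \<Longrightarrow> x = 0"
    and l_add: "\<And>x y. \<lbrakk>x \<in> V; y \<in> V\<rbrakk> \<Longrightarrow> l (x + y) = l x + l y"
    and l_scale: "\<And>c x. x \<in> V \<Longrightarrow> l (scale c x) = c * l x"
  shows "\<exists>!v. v \<in> V \<and> (\<forall>\<psi> \<in> V. form v \<psi> = l \<psi>)"
proof -
  interpret vector_space scale by (fact vs)
  obtain C where C: "C \<subseteq> V" "independent C" "V \<subseteq> span C"
    by (rule maximal_independent_subset)
  have "finite C"
    using C B independent_span_bound[OF B(1) C(2)] by blast
  have diff_V: "x - y \<in> V" if "x \<in> V" "y \<in> V" for x y
    using that V by (simp add: subspace_diff)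
  have form_diff: "form (x - y) z = form x z - form y z" if "x \<in> V" "y \<in> V" "z \<in> V" for x y z
    using form_add[of "x - y" y z] that diff_V by simp
  have l_diff: "l (x - y) = l x - l y" if "x \<in> V" "y \<in> V" for x y
    using l_add[of "x - y" y] that diff_V by simp
  have represent: "\<exists>v \<in> span C. \<forall>\<psi> \<in> span C. form v \<psi> = m \<psi>"
    if "\<And>x y. \<lbrakk>x \<in> V; y \<in> V\<rbrakk> \<Longrightarrow> m (x + y) = m x + m y"
      and "\<And>c x. x \<in> V \<Longrightarrow> m (scale c x) = c * m x" for m :: "'v \<Rightarrow> real"
    using \<open>finite C\<close> C(1) that
  proof (induction C arbitrary: m rule: finite_induct)
    case empty
    have "0 \<in> V" using V by (rule subspace_0)
    then show ?case
      using form_scale[of 0 0 0] empty(3)[of 0 0] by simp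
  next
    case (insert e C)
    have e: "e \<in> V" and CV: "C \<subseteq> V"
      using insert.prems(1) by auto
    then have span_V: "x \<in> V" if "x \<in> span C" for x
      using span_minimal[OF CV V] that by blast
    obtain q where q: "q \<in> span C" "\<And>\<psi>. \<psi> \<in> span C \<Longrightarrow> form q \<psi> = form e \<psi>"
      using insert.IH[OF CV, of "form e"] form_add form_scale e form_sym by metis
    obtain v where v: "v \<in> span C" "\<And>\<psi>. \<psi> \<in> span C \<Longrightarrow> form v \<psi> = m \<psi>"
      using insert.IH[OF CV, of m] insert.prems(2,3) by metis
    \<comment> \<open>\<open>n\<close> is the component of \<open>e\<close> orthogonal to \<open>span C\<close>; adding \<open>scale t n\<close> to \<open>v\<close> changes only the value at \<open>n\<close>.\<close>
    define n where "n = e - q"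
    define t where "t = (m n - form v n) / form n n"
    have nV: "n \<in> V" and vV: "v \<in> V"
      using q(1) v(1) e span_V by (auto simp: n_def diff_V)
    have orth: "form n \<psi> = 0" if "\<psi> \<in> span C" for \<psi>
      using that e q span_V by (simp add: n_def form_diff)
    \<comment> \<open>If \<open>e\<close> lies in the span already, then \<open>n = 0\<close>, the quotient \<open>t\<close> has denominator \<open>0\<close>, and both sides vanish.\<close>
    have t: "t * form n n = m n - form v n"
    proof (cases "form n n = 0")
      case True
      then have "n = 0" using form_def nV by blast
      then show ?thesis
        using True form_scale[of v v 0] form_sym[of v 0] insert.prems(3)[of v 0] vV by simp
    qed (simp add: t_def)
    show ?case
    proof (intro bexI ballI)
      have span_mono: "x \<in> span (insert e C)" if "x \<in> span C" for x
        using that span_mono[of C "insert e C"] by blast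
      show "v + scale t n \<in> span (insert e C)"
        unfolding n_def
        using span_mono[OF v(1)] span_mono[OF q(1)] span_base[of e "insert e C"]
        by (intro span_add span_scale span_diff) auto
      fix \<psi> assume "\<psi> \<in> span (insert e C)"
      then obtain k where "\<psi> - scale k e \<in> span C"
        by (auto simp: span_insert)
      then have s: "(\<psi> - scale k e) + scale k q \<in> span C" (is "?s \<in> _")
        using q(1) by (intro span_add span_scale)
      have \<psi>: "\<psi> = ?s + scale k n"
        by (simp add: n_def scale_right_diff_distrib)
      have sV: "?s \<in> V" using s span_V by blast
      have knV: "scale k n \<in> V" "scale t n \<in> V"
        using nV V by (auto intro: subspace_scale)
      have eq: "form x (?s + scale k n) = form x ?s + k * form x n" if "x \<in> V" for x
        using form_add[OF sV knV(1) that] form_scale[OF nV that] by (simp add: form_sym)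
      have "form (v + scale t n) (?s + scale k n)
          = form v ?s + k * form v n + t * (form n ?s + k * form n n)"
        using form_add[OF vV knV(2)] form_scale[OF nV] eq[OF vV] eq[OF nV] V sV knV
        by (simp add: subspace_add)
      also have "\<dots> = m ?s + k * (form v n + t * form n n)"
        using orth[OF s] v(2)[OF s] by (simp add: algebra_simps)
      also have "\<dots> = m ?s + m (scale k n)"
        using t insert.prems(3)[OF nV] by simp
      also have "\<dots> = m (?s + scale k n)"
        using insert.prems(2) sV knV(1) by simp
      finally show "form (v + scale t n) \<psi> = m \<psi>"
        using \<psi> by simp
    qed
  qed
  have span_C: "span C = V"
    using span_minimal[OF C(1) V] C(3) by blast
  obtain v where v: "v \<in> V" "\<forall>\<psi> \<in> V. form v \<psi> = l \<psi>"
    using represent[of l] l_add l_scale unfolding span_C by blast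
  moreover have "w = v" if "w \<in> V" "\<forall>\<psi> \<in> V. form w \<psi> = l \<psi>" for w
  proof -
    have "form (w - v) (w - v) = 0"
      using that v diff_V by (simp add: form_diff)
    then show ?thesis
      using form_def[of "w - v"] that(1) v(1) diff_V by simp
  qed
  ultimately show ?thesis by blast
qed


section \<open>The finite element space and its energy form\<close>

lemma sum_apply: "(\<Sum>i\<in>I. f i) x = (\<Sum>i\<in>I. f i x)"
  by (induction I rule: infinite_finite_induct) auto

locale mesh =
  fixes a b :: real and \<T> :: "real set set" and r :: nat
  assumes ab: "a < b" and partition: "mesh_partition \<T> {a<..<b}"
begin

abbreviation V :: "(real \<Rightarrow> real) set" where
  "V \<equiv> fe_space {a<..<b} \<T> r"

abbreviation L :: "real measure" where
  "L \<equiv> lebesgue_on {a<..<b}"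

definition nodes :: "real set" where
  "nodes = (\<Union>T\<in>\<T>. frontier T)"

text \<open>The one-sided derivatives may differ at a node. The value \<open>0\<close> there keeps \<open>pw_deriv\<close> linear in \<open>w\<close> at every
point of \<open>[a, b]\<close>, although \<open>deriv\<close> is unspecified where \<open>w\<close> is not differentiable.\<close>
definition pw_deriv :: "(real \<Rightarrow> real) \<Rightarrow> real \<Rightarrow> real" where
  "pw_deriv w x = (if x \<in> nodes then 0 else deriv w x)"

lemma
  shows finite_cells: "finite \<T>" and cells_cover: "\<Union>\<T> = {a..b}"
    and cell_interval: "T \<in> \<T> \<Longrightarrow> \<exists>c d. T = {c..d}"
    and cells_disjoint: "\<lbrakk>S \<in> \<T>; T \<in> \<T>; S \<noteq> T\<rbrakk> \<Longrightarrow> interior S \<inter> interior T = {}"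
  using partition ab division_ofD[of \<T> "{a..b}"] unfolding mesh_partition_def by auto

lemma finite_nodes: "finite nodes"
proof -
  have "finite (frontier T)" if T: "T \<in> \<T>" for T
  proof -
    obtain c d where "T = cbox c d" using cell_interval[OF T] by auto
    then have "frontier T \<subseteq> {c, d}"
      by (auto simp: frontier_def)
    then show ?thesis by (rule finite_subset) simp
  qed
  then show ?thesis using finite_cells by (simp add: nodes_def)
qed

lemma non_node_in_cell_interior:
  assumes "x \<in> {a..b}" "x \<notin> nodes"
  obtains T where "T \<in> \<T>" "x \<in> interior T"
proof -
  obtain T where "T \<in> \<T>" "x \<in> T" using assms(1) cells_cover by blast
  moreover have "x \<in> closure T" using \<open>x \<in> T\<close> closure_subset by blast
  ultimately show ?thesis using assms(2) that by (auto simp: nodes_def frontier_def)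
qed

lemma fe_space_dest:
  assumes "w \<in> V"
  shows "continuous_on {a..b} w" "w a = 0" "w b = 0" "x \<notin> {a..b} \<Longrightarrow> w x = 0"
    and "T \<in> \<T> \<Longrightarrow> \<exists>P. degree P \<le> r - 1 \<and> (\<forall>x\<in>T. w x = poly P x)"
  using assms ab by (auto simp: fe_space_def frontier_def)

lemma fe_space_subspace:
  shows "(\<lambda>_. 0) \<in> V"
    and "\<lbrakk>w \<in> V; z \<in> V\<rbrakk> \<Longrightarrow> (\<lambda>x. w x + z x) \<in> V"
    and "w \<in> V \<Longrightarrow> (\<lambda>x. c * w x) \<in> V"
proof -
  show "(\<lambda>_. 0) \<in> V"
    by (auto simp: fe_space_def intro!: exI[of _ 0])
  show "(\<lambda>x. w x + z x) \<in> V" if w: "w \<in> V" and z: "z \<in> V"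
    unfolding fe_space_def
  proof (intro CollectI conjI ballI)
    fix T assume T: "T \<in> \<T>"
    obtain P Q where "degree P \<le> r - 1" "\<forall>x\<in>T. w x = poly P x"
      "degree Q \<le> r - 1" "\<forall>x\<in>T. z x = poly Q x"
      using fe_space_dest(5)[OF w T] fe_space_dest(5)[OF z T] by blast
    then show "\<exists>P. degree P \<le> r - 1 \<and> (\<forall>x\<in>T. w x + z x = poly P x)"
      by (intro exI[of _ "P + Q"]) (auto simp: degree_add_le)
  qed (use w z in \<open>auto simp: fe_space_def intro: continuous_on_add\<close>)
  show "(\<lambda>x. c * w x) \<in> V" if w: "w \<in> V"
    unfolding fe_space_def
  proof (intro CollectI conjI ballI)
    fix T assume T: "T \<in> \<T>"
    obtain P where "degree P \<le> r - 1" "\<forall>x\<in>T. w x = poly P x"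
      using fe_space_dest(5)[OF w T] by blast
    then show "\<exists>P. degree P \<le> r - 1 \<and> (\<forall>x\<in>T. c * w x = poly P x)"
      by (intro exI[of _ "smult c P"]) (auto intro: order_trans[OF degree_smult_le])
  qed (use w in \<open>auto simp: fe_space_def intro: continuous_on_mult_left\<close>)
qed

lemma has_derivative_in_cell_interior:
  assumes "T \<in> \<T>" "x \<in> interior T" "\<forall>y\<in>T. w y = poly P y"
  shows "(w has_real_derivative poly (pderiv P) x) (at x)"
  using poly_DERIV[of P x]
  by (rule has_field_derivative_transform_within_open[where S="interior T"])
     (use assms interior_subset[of T] in auto)

lemma pw_deriv_has_derivative:
  assumes w: "w \<in> V" and x: "x \<in> {a..b}" "x \<notin> nodes"
  shows "(w has_real_derivative pw_deriv w x) (at x)"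
proof -
  obtain T where T: "T \<in> \<T>" "x \<in> interior T" using non_node_in_cell_interior[OF x] .
  obtain P where P: "\<forall>y\<in>T. w y = poly P y" using fe_space_dest(5)[OF w T(1)] by blast
  have D: "(w has_real_derivative poly (pderiv P) x) (at x)"
    by (rule has_derivative_in_cell_interior[OF T P])
  with x(2) have "pw_deriv w x = poly (pderiv P) x"
    by (simp add: pw_deriv_def DERIV_imp_deriv)
  with D show ?thesis by simp
qed

lemma pw_deriv_add:
  assumes "w \<in> V" "z \<in> V" "x \<in> {a..b}"
  shows "pw_deriv (\<lambda>x. w x + z x) x = pw_deriv w x + pw_deriv z x"
proof (cases "x \<in> nodes")
  case False
  have "((\<lambda>x. w x + z x) has_real_derivative pw_deriv w x + pw_deriv z x) (at x)"
    using assms False by (intro DERIV_add pw_deriv_has_derivative)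
  with False show ?thesis by (simp add: pw_deriv_def DERIV_imp_deriv)
qed (simp add: pw_deriv_def)

lemma pw_deriv_scale:
  assumes "w \<in> V" "x \<in> {a..b}"
  shows "pw_deriv (\<lambda>x. c * w x) x = c * pw_deriv w x"
proof (cases "x \<in> nodes")
  case False
  have "((\<lambda>x. c * w x) has_real_derivative c * pw_deriv w x) (at x)"
    using assms False by (intro DERIV_cmult pw_deriv_has_derivative)
  with False show ?thesis by (simp add: pw_deriv_def DERIV_imp_deriv)
qed (simp add: pw_deriv_def)

definition bounded_measurable :: "(real \<Rightarrow> real) \<Rightarrow> bool" where
  "bounded_measurable g \<longleftrightarrow> g \<in> borel_measurable L \<and> (\<exists>C. \<forall>x\<in>{a<..<b}. \<bar>g x\<bar> \<le> C)"

lemma bounded_measurableI: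
  "\<lbrakk>g \<in> borel_measurable L; \<And>x. x \<in> {a<..<b} \<Longrightarrow> \<bar>g x\<bar> \<le> C\<rbrakk> \<Longrightarrow> bounded_measurable g"
  unfolding bounded_measurable_def by blast

lemma bounded_measurable_mult:
  assumes "bounded_measurable f" "bounded_measurable g"
  shows "bounded_measurable (\<lambda>x. f x * g x)"
proof -
  obtain C D where "\<forall>x\<in>{a<..<b}. \<bar>f x\<bar> \<le> C" "\<forall>x\<in>{a<..<b}. \<bar>g x\<bar> \<le> D"
    using assms by (auto simp: bounded_measurable_def)
  then have "\<forall>x\<in>{a<..<b}. \<bar>f x * g x\<bar> \<le> C * D"
    by (force simp: abs_mult intro!: mult_mono)
  then show ?thesis
    using assms unfolding bounded_measurable_def by auto
qed

lemma integrable_const: "integrable L (\<lambda>x. c :: real)"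
proof -
  interpret finite_measure L
    by (rule finite_measure_lebesgue_on) simp
  show ?thesis by simp
qed

lemma integrable_mult_bounded_measurable:
  "\<lbrakk>integrable L f; bounded_measurable g\<rbrakk> \<Longrightarrow> integrable L (\<lambda>x. f x * g x)"
  using integrable_bounded_mult[of L f g] unfolding bounded_measurable_def space_lebesgue_on by blast

lemma bounded_measurable_integrable: "bounded_measurable g \<Longrightarrow> integrable L g"
  using integrable_mult_bounded_measurable[OF integrable_const[of 1]] by simp

lemma continuous_bounded_measurable:
  assumes "continuous_on {a..b} g"
  shows "bounded_measurable g"
proof -
  have "g \<in> borel_measurable L"
    using assms by (intro continuous_imp_measurable_on_sets_lebesgue)
      (auto intro: continuous_on_subset)
  moreover obtain C where "\<forall>x\<in>{a..b}. \<bar>g x\<bar> \<le> C"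
    using compact_imp_bounded[OF compact_continuous_image[OF assms]] by (auto simp: bounded_iff)
  ultimately show ?thesis
    unfolding bounded_measurable_def by (metis greaterThanLessThan_subseteq_atLeastAtMost_iff order_refl subsetD)
qed

lemma fe_space_bounded_measurable: "w \<in> V \<Longrightarrow> bounded_measurable w"
  by (intro continuous_bounded_measurable fe_space_dest)

text \<open>On the finitely many cells the derivative is a polynomial. The interiors of the cells are disjoint,
so off the nodes it is the sum of these polynomials, each cut off to the interior of its cell.\<close>
lemma pw_deriv_bounded_measurable:
  assumes w: "w \<in> V"
  shows "bounded_measurable (pw_deriv w)"
proof -
  obtain P where P: "\<And>T x. \<lbrakk>T \<in> \<T>; x \<in> T\<rbrakk> \<Longrightarrow> w x = poly (P T) x"
    using fe_space_dest(5)[OF w] by metis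
  define g where "g x = (if x \<in> nodes then 0 else
    \<Sum>T\<in>\<T>. indicator (interior T) x * poly (pderiv (P T)) x)" for x
  have eq: "pw_deriv w x = g x" if x: "x \<in> {a<..<b}" for x
  proof (cases "x \<in> nodes")
    case False
    obtain T where T: "T \<in> \<T>" "x \<in> interior T"
      using non_node_in_cell_interior[of x] x False by auto
    have "(\<Sum>S\<in>\<T>. indicator (interior S) x * poly (pderiv (P S)) x)
        = (\<Sum>S\<in>\<T>. if S = T then poly (pderiv (P T)) x else 0)"
      using T cells_disjoint by (intro sum.cong) (auto simp: indicator_def)
    also have "\<dots> = poly (pderiv (P T)) x"
      using T finite_cells by simp
    also have "\<dots> = deriv w x"
      using has_derivative_in_cell_interior[OF T, of w "P T"] P[OF T(1)]
      by (auto dest: DERIV_imp_deriv)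
    finally show ?thesis using False by (simp add: g_def pw_deriv_def)
  qed (simp add: g_def pw_deriv_def)
  have poly_meas [measurable]: "poly Q \<in> borel_measurable borel" for Q :: "real poly"
    by (intro borel_measurable_continuous_onI continuous_intros)
  have nodes_meas [measurable]: "nodes \<in> sets borel"
    using finite_nodes by (intro borel_closed finite_imp_closed)
  have "g \<in> borel_measurable borel"
    unfolding g_def[abs_def] by measurable
  then have "g \<in> borel_measurable L"
    by (intro measurable_restrict_space1 measurable_completion) simp
  then have meas: "pw_deriv w \<in> borel_measurable L"
    using eq measurable_lebesgue_cong[of "{a<..<b}" "pw_deriv w" g] by blast
  have "continuous_on {a..b} (\<lambda>x. \<Sum>T\<in>\<T>. \<bar>poly (pderiv (P T)) x\<bar>)"
    by (intro continuous_intros)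
  then obtain C where C: "\<forall>x\<in>{a<..<b}. \<bar>\<Sum>T\<in>\<T>. \<bar>poly (pderiv (P T)) x\<bar>\<bar> \<le> C"
    using continuous_bounded_measurable unfolding bounded_measurable_def by blast
  have "\<bar>pw_deriv w x\<bar> \<le> C" if x: "x \<in> {a<..<b}" for x
  proof -
    have "\<bar>\<Sum>T\<in>\<T>. indicator (interior T) x * poly (pderiv (P T)) x\<bar>
        \<le> (\<Sum>T\<in>\<T>. \<bar>indicator (interior T) x * poly (pderiv (P T)) x\<bar>)"
      by (rule sum_abs)
    also have "\<dots> \<le> (\<Sum>T\<in>\<T>. \<bar>poly (pderiv (P T)) x\<bar>)"
      by (intro sum_mono) (auto simp: indicator_def)
    also have "\<dots> \<le> C"
      using bspec[OF C x] by linarith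
    finally have "\<bar>\<Sum>T\<in>\<T>. indicator (interior T) x * poly (pderiv (P T)) x\<bar> \<le> C" .
    then have "\<bar>g x\<bar> \<le> C"
      by (cases "x \<in> nodes") (auto simp: g_def)
    then show ?thesis using eq[OF x] by simp
  qed
  with meas show ?thesis by (rule bounded_measurableI)
qed

text \<open>Integration by parts: \<open>w \<phi>\<close> is continuous and differentiable off the nodes, a finite set that the
fundamental theorem of calculus tolerates, and it vanishes at both end points.\<close>
lemma pw_deriv_has_weak_deriv:
  assumes w: "w \<in> V"
  shows "has_weak_deriv {a<..<b} w (pw_deriv w)"
proof -
  have loc: "locally_integrable_on g {a<..<b}" if "bounded_measurable g" for g
    unfolding locally_integrable_on_def
  proof (intro allI impI)
    fix K :: "real set" assume K: "compact K \<and> K \<subseteq> {a<..<b}"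
    have "set_integrable lebesgue {a<..<b} g"
      using bounded_measurable_integrable[OF that]
      by (simp add: set_integrable_def integrable_restrict_space)
    then have "set_integrable lebesgue K g"
      by (rule set_integrable_subset) (use K in \<open>auto intro: lmeasurable_compact fmeasurableD\<close>)
    then show "integrable (lebesgue_on K) g"
      using K by (subst integrable_restrict_space)
        (auto simp: set_integrable_def intro: lmeasurable_compact fmeasurableD)
  qed
  have "L2_inner {a<..<b} w (deriv \<phi>) = - L2_inner {a<..<b} (pw_deriv w) \<phi>"
    if \<phi>: "\<phi> \<in> test_functions {a<..<b}" for \<phi>
  proof -
    have bm: "bounded_measurable (\<lambda>x. w x * deriv \<phi> x)" "bounded_measurable (\<lambda>x. pw_deriv w x * \<phi> x)"
      using w test_function_properties(2,3)[OF \<phi>]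
      by (blast intro: bounded_measurable_mult fe_space_bounded_measurable
          pw_deriv_bounded_measurable continuous_bounded_measurable)+
    have "((\<lambda>x. w x * deriv \<phi> x + pw_deriv w x * \<phi> x) has_integral
        (\<integral>x. w x * deriv \<phi> x + pw_deriv w x * \<phi> x \<partial>L)) {a<..<b}"
      using bm[THEN bounded_measurable_integrable]
      by (intro has_integral_integral_lebesgue_on) auto
    moreover have "((\<lambda>x. w x * deriv \<phi> x + pw_deriv w x * \<phi> x) has_integral
        w b * \<phi> b - w a * \<phi> a) {a..b}"
    proof (rule fundamental_theorem_of_calculus_strong[OF finite_nodes])
      show "continuous_on {a..b} (\<lambda>x. w x * \<phi> x)"
        using w \<phi> by (intro continuous_on_mult fe_space_dest test_function_properties)
      fix x assume "x \<in> {a..b} - nodes"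
      then have "((\<lambda>x. w x * \<phi> x) has_real_derivative pw_deriv w x * \<phi> x + deriv \<phi> x * w x) (at x)"
        using w \<phi> by (intro DERIV_mult pw_deriv_has_derivative test_function_properties) auto
      then show "((\<lambda>x. w x * \<phi> x) has_vector_derivative w x * deriv \<phi> x + pw_deriv w x * \<phi> x) (at x)"
        by (simp add: has_real_derivative_iff_has_vector_derivative algebra_simps)
    qed (use ab in simp)
    ultimately have "(\<integral>x. w x * deriv \<phi> x + pw_deriv w x * \<phi> x \<partial>L) = w b * \<phi> b - w a * \<phi> a"
      using has_integral_unique has_integral_Icc_iff_Ioo by blast
    then have "(\<integral>x. w x * deriv \<phi> x \<partial>L) + (\<integral>x. pw_deriv w x * \<phi> x \<partial>L) = 0"
      using bm[THEN bounded_measurable_integrable] fe_space_dest(2,3)[OF w] by simp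
    then show ?thesis by (simp add: L2_inner_def)
  qed
  with loc[OF fe_space_bounded_measurable[OF w]] loc[OF pw_deriv_bounded_measurable[OF w]]
  show ?thesis by (auto simp: has_weak_deriv_def)
qed

lemma weak_deriv_eq_pw_deriv:
  assumes w: "w \<in> V"
  shows "AE x in L. weak_deriv {a<..<b} w x = pw_deriv w x"
proof -
  have "has_weak_deriv {a<..<b} w (weak_deriv {a<..<b} w)"
    unfolding weak_deriv_def using pw_deriv_has_weak_deriv[OF w] by (rule someI[where P="has_weak_deriv {a<..<b} w"])
  then show ?thesis
    using pw_deriv_has_weak_deriv[OF w] by (rule weak_deriv_unique)
qed

lemma weak_deriv_measurable:
  assumes w: "w \<in> V"
  shows "weak_deriv {a<..<b} w \<in> borel_measurable L"
proof -
  have "(\<lambda>x. if x \<in> {a<..<b} then pw_deriv w x else 0) \<in> borel_measurable lebesgue"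
    using pw_deriv_bounded_measurable[OF w] unfolding bounded_measurable_def
    by (intro borel_measurable_if_I) auto
  moreover have "AE x in lebesgue. (if x \<in> {a<..<b} then pw_deriv w x else 0)
      = (if x \<in> {a<..<b} then weak_deriv {a<..<b} w x else 0)"
    using weak_deriv_eq_pw_deriv[OF w] by (auto simp: AE_restrict_space_iff)
  ultimately have "(\<lambda>x. if x \<in> {a<..<b} then weak_deriv {a<..<b} w x else 0) \<in> borel_measurable lebesgue"
    by (rule borel_measurable_AE)
  then show ?thesis
    by (rule borel_measurable_if_D)
qed

definition energy :: "(real \<Rightarrow> real) \<Rightarrow> (real \<Rightarrow> real) \<Rightarrow> real" where
  "energy w z = L2_inner {a<..<b} (pw_deriv w) (pw_deriv z)"

text \<open>From here on the unspecified weak derivatives in the Galerkin equations can be replaced by classical ones.\<close>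
lemma energy_eq_L2_inner_weak_deriv:
  assumes "w \<in> V" "z \<in> V"
  shows "L2_inner {a<..<b} (weak_deriv {a<..<b} w) (weak_deriv {a<..<b} z) = energy w z"
  unfolding energy_def L2_inner_def
proof (rule integral_cong_AE)
  show "AE x in L. weak_deriv {a<..<b} w x * weak_deriv {a<..<b} z x = pw_deriv w x * pw_deriv z x"
    using weak_deriv_eq_pw_deriv[OF assms(1)] weak_deriv_eq_pw_deriv[OF assms(2)]
    by eventually_elim simp
qed (use assms weak_deriv_measurable pw_deriv_bounded_measurable in
    \<open>auto simp: bounded_measurable_def intro!: borel_measurable_times\<close>)

lemma energy_integrable:
  assumes "w \<in> V" "z \<in> V"
  shows "integrable L (\<lambda>x. pw_deriv w x * pw_deriv z x)"
  using assms by (intro bounded_measurable_integrable bounded_measurable_mult pw_deriv_bounded_measurable)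

lemma energy_sym: "energy w z = energy z w"
  by (simp add: energy_def L2_inner_def mult.commute)

lemma energy_add:
  assumes "w \<in> V" "y \<in> V" "z \<in> V"
  shows "energy (\<lambda>x. w x + y x) z = energy w z + energy y z"
proof -
  have "energy (\<lambda>x. w x + y x) z = (\<integral>x. pw_deriv w x * pw_deriv z x + pw_deriv y x * pw_deriv z x \<partial>L)"
    unfolding energy_def L2_inner_def
    by (rule Bochner_Integration.integral_cong) (use assms in \<open>auto simp: pw_deriv_add distrib_right\<close>)
  then show ?thesis
    using assms energy_integrable by (simp add: energy_def L2_inner_def)
qed

lemma energy_scale:
  assumes "w \<in> V" "z \<in> V"
  shows "energy (\<lambda>x. c * w x) z = c * energy w z"
proof -
  have "energy (\<lambda>x. c * w x) z = (\<integral>x. c * (pw_deriv w x * pw_deriv z x) \<partial>L)"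
    unfolding energy_def L2_inner_def
    by (rule Bochner_Integration.integral_cong) (use assms in \<open>auto simp: pw_deriv_scale\<close>)
  then show ?thesis
    by (simp add: energy_def L2_inner_def)
qed

text \<open>A function with vanishing energy has derivative \<open>0\<close> almost everywhere. It is the integral of this
derivative, because it is continuous and differentiable off a finite set.\<close>
lemma energy_definite:
  assumes w: "w \<in> V" and zero: "energy w w = 0"
  shows "w = (\<lambda>_. 0)"
proof
  fix x
  show "w x = 0"
  proof (cases "x \<in> {a..b}")
    case True
    have "AE y in L. pw_deriv w y * pw_deriv w y = 0"
      using zero integral_nonneg_eq_0_iff_AE[OF energy_integrable[OF w w]]
      by (simp add: energy_def L2_inner_def)
    then have "AE y in lebesgue. y \<in> {a<..<b} \<longrightarrow> pw_deriv w y = 0"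
      by (simp add: AE_restrict_space_iff)
    then obtain N where N: "N \<in> null_sets lebesgue" "\<And>y. \<lbrakk>y \<notin> N; y \<in> {a<..<b}\<rbrakk> \<Longrightarrow> pw_deriv w y = 0"
      by (auto simp: eventually_ae_filter)
    have "negligible (N \<union> {a, b})"
      using N(1) by (simp add: negligible_iff_null_sets[symmetric])
    then have "(pw_deriv w has_integral 0) {a..x}"
      by (rule has_integral_spike[OF _ _ has_integral_0]) (use True N(2) in auto)
    moreover have "(pw_deriv w has_integral (w x - w a)) {a..x}"
    proof (rule fundamental_theorem_of_calculus_strong[OF finite_nodes])
      show "continuous_on {a..x} w"
        using fe_space_dest(1)[OF w] True by (auto intro: continuous_on_subset)
      show "(w has_vector_derivative pw_deriv w y) (at y)" if "y \<in> {a..x} - nodes" for y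
        using pw_deriv_has_derivative[OF w, of y] that True
        by (simp add: has_real_derivative_iff_has_vector_derivative)
    qed (use True in simp)
    ultimately have "0 = w x - w a"
      by (rule has_integral_unique)
    then show ?thesis
      using fe_space_dest(2)[OF w] by simp
  qed (use fe_space_dest(4)[OF w] in simp)
qed

text \<open>The spanning functions are monomials cut off to a single cell; in general they are discontinuous and lie outside
the space. Neighbouring cells share a node, where summing over all cells would count a
value twice, so every point is assigned to one cell \<open>\<tau> x\<close> that contains it.\<close>
lemma fe_space_in_finite_span:
  "\<exists>B. finite B \<and> V \<subseteq> module.span (\<lambda>c (f :: real \<Rightarrow> real) x. c * f x) B"
proof -
  interpret vector_space "\<lambda>c (f :: real \<Rightarrow> real) x. c * f x"
    by standard (auto simp: fun_eq_iff algebra_simps)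
  have "\<forall>x\<in>{a..b}. \<exists>T. T \<in> \<T> \<and> x \<in> T"
    using cells_cover by auto
  from bchoice[OF this] obtain \<tau> where \<tau>: "\<And>x. x \<in> {a..b} \<Longrightarrow> \<tau> x \<in> \<T> \<and> x \<in> \<tau> x"
    by blast
  define e where "e = (\<lambda>(T, i) x. if x \<in> {a..b} \<and> \<tau> x = T then x ^ i else (0::real))"
  have "w \<in> span (e ` (\<T> \<times> {..r - 1}))" if w: "w \<in> V" for w
  proof -
    from fe_space_dest(5)[OF w]
    have "\<forall>T\<in>\<T>. \<exists>P. degree P \<le> r - 1 \<and> (\<forall>x\<in>T. w x = poly P x)"
      by blast
    from bchoice[OF this] obtain P where
      P: "\<And>T. T \<in> \<T> \<Longrightarrow> degree (P T) \<le> r - 1 \<and> (\<forall>x\<in>T. w x = poly (P T) x)"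
      by blast
    have "w = (\<Sum>(T, i)\<in>\<T> \<times> {..r - 1}. (\<lambda>x. coeff (P T) i * e (T, i) x))"
    proof
      fix x
      show "w x = (\<Sum>(T, i)\<in>\<T> \<times> {..r - 1}. (\<lambda>x. coeff (P T) i * e (T, i) x)) x"
      proof (cases "x \<in> {a..b}")
        case True
        have "(\<Sum>(T, i)\<in>\<T> \<times> {..r - 1}. (\<lambda>x. coeff (P T) i * e (T, i) x)) x
            = (\<Sum>T\<in>\<T>. \<Sum>i\<le>r - 1. coeff (P T) i * e (T, i) x)"
          by (simp add: sum_apply sum.cartesian_product case_prod_unfold)
        also have "\<dots> = (\<Sum>T\<in>\<T>. if T = \<tau> x then \<Sum>i\<le>r - 1. coeff (P T) i * x ^ i else 0)"
          using True by (intro sum.cong) (auto simp: e_def)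
        also have "\<dots> = (\<Sum>i\<le>r - 1. coeff (P (\<tau> x)) i * x ^ i)"
          using \<tau>[OF True] finite_cells by simp
        also have "\<dots> = poly (P (\<tau> x)) x"
          unfolding poly_altdef using P[of "\<tau> x"] \<tau>[OF True]
          by (intro sum.mono_neutral_right) (auto simp: coeff_eq_0)
        also have "\<dots> = w x"
          using P[of "\<tau> x"] \<tau>[OF True] by simp
        finally show ?thesis by simp
      next
        case False
        then show ?thesis
          using fe_space_dest(4)[OF w False] by (auto simp: sum_apply e_def case_prod_unfold)
      qed
    qed
    also have "\<dots> \<in> span (e ` (\<T> \<times> {..r - 1}))"
    proof (rule span_sum)
      fix z assume "z \<in> \<T> \<times> {..r - 1}"
      then have "e z \<in> span (e ` (\<T> \<times> {..r - 1}))"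
        by (intro span_base imageI)
      from span_scale[OF this, of "coeff (P (fst z)) (snd z)"]
      show "(case z of (T, i) \<Rightarrow> \<lambda>x. coeff (P T) i * e (T, i) x) \<in> span (e ` (\<T> \<times> {..r - 1}))"
        by (simp add: case_prod_unfold)
    qed
    finally show ?thesis .
  qed
  then show ?thesis
    using finite_cells by (intro exI[of _ "e ` (\<T> \<times> {..r - 1})"]) auto
qed

text \<open>Functionals \<open>\<psi> \<mapsto> (g, \<psi>)\<close> are linear because members of the finite element space are bounded, so that all
products \<open>g \<psi>\<close> are integrable. Hence the representation theorem applies with the energy form.\<close>
lemma galerkin_unique_solvable:
  assumes g: "integrable L g"
  shows "\<exists>!v. v \<in> V \<and> (\<forall>\<psi>\<in>V. L2_inner {a<..<b} (weak_deriv {a<..<b} v) (weak_deriv {a<..<b} \<psi>)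
    = - L2_inner {a<..<b} g \<psi>)"
proof -
  let ?scale = "\<lambda>c (f :: real \<Rightarrow> real) x. c * f x"
  have int: "integrable L (\<lambda>x. g x * \<psi> x)" if "\<psi> \<in> V" for \<psi>
    using g that by (intro integrable_mult_bounded_measurable fe_space_bounded_measurable)
  interpret vector_space ?scale
    by standard (auto simp: fun_eq_iff algebra_simps)
  obtain B where B: "finite B" "V \<subseteq> span B"
    using fe_space_in_finite_span by blast
  have "\<exists>!v. v \<in> V \<and> (\<forall>\<psi>\<in>V. energy v \<psi> = - L2_inner {a<..<b} g \<psi>)"
  proof (rule finite_dim_riesz[OF vector_space_axioms _ B])
    show "subspace V"
      using fe_space_subspace by (auto simp: subspace_def plus_fun_def zero_fun_def)
    show "energy (x + y) z = energy x z + energy y z" if "x \<in> V" "y \<in> V" "z \<in> V" for x y z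
      using energy_add[OF that] by (simp add: plus_fun_def)
    show "x = 0" if "x \<in> V" "energy x x = 0" for x
      using energy_definite[OF that] by (simp add: zero_fun_def)
    show "- L2_inner {a<..<b} g (x + y) = - L2_inner {a<..<b} g x + - L2_inner {a<..<b} g y"
      if "x \<in> V" "y \<in> V" for x y
      using int that by (simp add: L2_inner_def distrib_left)
    show "- L2_inner {a<..<b} g (\<lambda>t. c * x t) = c * - L2_inner {a<..<b} g x" for c x
      by (simp add: L2_inner_def mult.left_commute)
    show "energy x y = energy y x" for x y
      by (rule energy_sym)
  qed (auto simp: energy_scale)
  then show ?thesis
    by (simp add: energy_eq_L2_inner_weak_deriv cong: conj_cong)
qed

text \<open>Because \<open>2 \<bar>t\<bar> \<le> 1 + t\<^sup>2\<close>, and constants are integrable on a bounded interval.\<close>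
lemma L2_space_integrable:
  assumes "f \<in> L2_space {a<..<b}"
  shows "integrable L f"
proof (rule Bochner_Integration.integrable_bound)
  show "integrable L (\<lambda>x. 1 + (f x)\<^sup>2)"
    using assms integrable_const by (auto simp: L2_space_def)
  show "AE x in L. norm (f x) \<le> norm (1 + (f x)\<^sup>2)"
  proof (rule AE_I2)
    fix x
    have "0 \<le> (\<bar>f x\<bar> - 1)\<^sup>2" by simp
    then have "2 * \<bar>f x\<bar> \<le> 1 + (f x)\<^sup>2" by (simp add: power2_diff)
    then show "norm (f x) \<le> norm (1 + (f x)\<^sup>2)" by simp
  qed
qed (use assms in \<open>simp add: L2_space_def\<close>)

text \<open>The absolute value is \<open>\<bar>v x\<bar>\<^bsup>q-1\<^esup>\<close>, with a positive exponent even when \<open>q < 2\<close> and the first factor alone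
is unbounded near the zeros of \<open>v\<close>. At a zero the product is \<open>0\<close>, as the convention on
\<open>\<bar>v\<bar>\<^bsup>q-2\<^esup> v\<close> demands.\<close>
lemma signed_power_bounded_measurable:
  assumes v: "bounded_measurable v" and q: "1 < q"
  shows "bounded_measurable (\<lambda>x. \<bar>v x\<bar> powr (q - 2) * v x)"
proof -
  have [measurable]: "v \<in> borel_measurable L" using v by (simp add: bounded_measurable_def)
  obtain C where C: "\<forall>x\<in>{a<..<b}. \<bar>v x\<bar> \<le> C"
    using v by (auto simp: bounded_measurable_def)
  have meas: "(\<lambda>x. \<bar>v x\<bar> powr (q - 2) * v x) \<in> borel_measurable L"
    by measurable
  have "\<bar>\<bar>v x\<bar> powr (q - 2) * v x\<bar> \<le> C powr (q - 1)" if "x \<in> {a<..<b}" for x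
  proof (cases "v x = 0")
    case False
    have "\<bar>\<bar>v x\<bar> powr (q - 2) * v x\<bar> = \<bar>v x\<bar> powr (q - 2) * \<bar>v x\<bar> powr 1"
      using False by (simp add: abs_mult)
    also have "\<dots> = \<bar>v x\<bar> powr (q - 1)"
      by (subst powr_add[symmetric]) simp
    also have "\<dots> \<le> C powr (q - 1)"
      using C that q by (intro powr_mono2) auto
    finally show ?thesis .
  qed simp
  with meas show ?thesis by (rule bounded_measurableI)
qed

end


section \<open>Unique solvability of the discrete system\<close>

theorem theorem4p2:
  fixes a b p q :: real and \<Omega> :: "real set" and \<T> :: "real set set" and r :: nat
    and f :: "real \<Rightarrow> real"
  assumes "a < b" and "\<Omega> = {a<..<b}"
    and "1 < p" and "q = p / (p - 1)"
    and "2 \<le> r" and "mesh_partition \<T> \<Omega>"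
    and "f \<in> L2_space \<Omega>"
  shows "\<exists>!s. s \<in> fe_space \<Omega> \<T> r \<times> fe_space \<Omega> \<T> r \<and>
    (case s of (u, v) \<Rightarrow>
      (\<forall>\<psi> \<in> fe_space \<Omega> \<T> r.
         L2_inner \<Omega> (weak_deriv \<Omega> v) (weak_deriv \<Omega> \<psi>) = - L2_inner \<Omega> f \<psi>) \<and>
      (\<forall>\<eta> \<in> fe_space \<Omega> \<T> r.
         L2_inner \<Omega> (weak_deriv \<Omega> u) (weak_deriv \<Omega> \<eta>) =
           - L2_inner \<Omega> (\<lambda>x. \<bar>v x\<bar> powr (q - 2) * v x) \<eta>))"
proof -
  interpret mesh a b \<T> r
    using assms by unfold_locales auto
  have q: "1 < q" using assms(3) unfolding assms(4) by (simp add: less_divide_eq)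
  let ?solves = "\<lambda>v g. v \<in> V \<and> (\<forall>\<psi> \<in> V.
    L2_inner \<Omega> (weak_deriv \<Omega> v) (weak_deriv \<Omega> \<psi>) = - L2_inner \<Omega> g \<psi>)"
  have ex1: "\<exists>!v. ?solves v g" if "integrable L g" for g
    using galerkin_unique_solvable[OF that] assms(2) by simp
  have ex1_v: "\<exists>!v. ?solves v f"
    using assms by (intro ex1 L2_space_integrable) simp
  have ex1_u: "\<exists>!u. ?solves u (\<lambda>x. \<bar>v x\<bar> powr (q - 2) * v x)" if "v \<in> V" for v
    using that q by (intro ex1 bounded_measurable_integrable signed_power_bounded_measurable
        fe_space_bounded_measurable)
  obtain v where v: "?solves v f" using ex1_v by blast
  obtain u where u: "?solves u (\<lambda>x. \<bar>v x\<bar> powr (q - 2) * v x)"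
    using ex1_u v by blast
  show ?thesis
  proof (rule ex1I[of _ "(u, v)"])
    fix s :: "(real \<Rightarrow> real) \<times> (real \<Rightarrow> real)"
    obtain u' v' where s: "s = (u', v')" by fastforce
    assume "s \<in> fe_space \<Omega> \<T> r \<times> fe_space \<Omega> \<T> r \<and>
    (case s of (u, v) \<Rightarrow>
      (\<forall>\<psi> \<in> fe_space \<Omega> \<T> r.
         L2_inner \<Omega> (weak_deriv \<Omega> v) (weak_deriv \<Omega> \<psi>) = - L2_inner \<Omega> f \<psi>) \<and>
      (\<forall>\<eta> \<in> fe_space \<Omega> \<T> r.
         L2_inner \<Omega> (weak_deriv \<Omega> u) (weak_deriv \<Omega> \<eta>) =
           - L2_inner \<Omega> (\<lambda>x. \<bar>v x\<bar> powr (q - 2) * v x) \<eta>))"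
    then have v': "?solves v' f" and u': "?solves u' (\<lambda>x. \<bar>v' x\<bar> powr (q - 2) * v' x)"
      using assms(2) s by simp_all
    have "v' = v" using ex1_v v v' by blast
    moreover have "u' = u" using ex1_u[of v] v u u' \<open>v' = v\<close> by blast
    ultimately show "s = (u, v)" using s by simp
  qed (use u v assms(2) in simp)
qed

end
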